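(* Let $N\ge 1$ and let $\psi_1,\dots,\psi_N\in\mathbb{C}^2$ be vectors with $\|\psi_i\|=1$ for all $i$, such that $\langle\psi_i|\psi_j\rangle\neq 0$ for all $i,j\in\{1,\dots,N\}$. Define $u_{ij}:=\dfrac{\langle\psi_i|\psi_j\rangle}{|\langle\psi_i|\psi_j\rangle|}\in U(1)$ for all $i,j$. Then the matrix $U=(u_{ij})_{1\le i,j\le N}$ belongs to $\mathrm{PC}_N(U(1))$.
   Context: $\langle\cdot|\cdot\rangle$ is the standard Hermitian inner product on $\mathbb{C}^2$, conjugate-linear in the first argument. $U(1)=\{z\in\mathbb{C}:|z|=1\}$. For a group $G$ (multiplicative, neutral element $e$), $\mathrm{PC}_N(G)$ is the set of $G$-valued reciprocal pairwise comparison matrices of order $N$, i.e. matrices $(u_{ij})_{1\le i,j\le N}$ with entries in $G$ such that $u_{ii}=e$ and $u_{ji}=u_{ij}^{-1}$ for all $i,j$. *)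

theory Defs
  imports "HOL-Analysis.Analysis" "HOL-Algebra.Group"
begin

text \<open>
  Hermitian inner product, conjugate-linear in the first argument. (The library's \<open>inner\<close>
  on \<open>complex ^ 'n\<close> is its real part only.)
\<close>
definition hinner :: "complex ^ 'n \<Rightarrow> complex ^ 'n \<Rightarrow> complex" where
  "hinner x y = (\<Sum>k\<in>UNIV. cnj (x $ k) * y $ k)"

text \<open>The library norm on \<open>complex ^ 'n\<close> is the one induced by \<^const>\<open>hinner\<close>.\<close>
lemma hinner_self: "hinner x x = complex_of_real ((norm x)\<^sup>2)"
proof -
  have "(norm x)\<^sup>2 = (\<Sum>k\<in>UNIV. (cmod (x $ k))\<^sup>2)"
    by (simp add: norm_vec_def L2_set_def sum_nonneg)
  then show ?thesis
    by (simp add: hinner_def complex_norm_square mult.commute del: of_real_power)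
qed

definition U1 :: "complex monoid" where
  "U1 = \<lparr>carrier = {z. cmod z = 1}, mult = (*), one = 1\<rparr>"

lemma group_U1: "group U1"
proof (rule groupI)
  fix x assume "x \<in> carrier U1"
  then show "\<exists>y\<in>carrier U1. y \<otimes>\<^bsub>U1\<^esub> x = \<one>\<^bsub>U1\<^esub>"
    by (intro bexI[of _ "inverse x"]) (auto simp: U1_def norm_inverse intro!: left_inverse)
qed (auto simp: U1_def norm_mult)

text \<open>
  Reciprocal pairwise comparison matrices over a group \<open>G\<close>; the order of the matrices is
  the cardinality of the index type \<open>'n\<close>.
\<close>
definition PC :: "('a, 'b) monoid_scheme \<Rightarrow> ('a ^ 'n ^ 'n) set" where
  "PC G = {u. (\<forall>i j. u $ i $ j \<in> carrier G) \<and>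
              (\<forall>i. u $ i $ i = \<one>\<^bsub>G\<^esub>) \<and>
              (\<forall>i j. u $ j $ i = inv\<^bsub>G\<^esub> (u $ i $ j))}"

end

theory Submission
  imports Defs
begin

text \<open>Hermitian symmetry (\<open>hinner_commute\<close>) makes opposite inner products
  conjugate, hence of equal modulus, so their phases are conjugate too. On the unit circle
  conjugation is inversion (\<open>inv_U1\<close>), which gives reciprocity. Diagonal phases are 1
  because each vector has norm 1.\<close>

lemma hinner_commute: "hinner y x = cnj (hinner x y)"
  by (simp add: hinner_def mult.commute)

text \<open>\<open>cnj z * z\<close> is the squared modulus of \<open>z\<close>, here 1, and
  inverses in a group are unique.\<close>

lemma inv_U1:
  assumes "cmod z = 1"
  shows "inv\<^bsub>U1\<^esub> z = cnj z"
proof -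
  interpret group U1 by (rule group_U1)
  show ?thesis
  proof (rule inv_equality)
    show "cnj z \<otimes>\<^bsub>U1\<^esub> z = \<one>\<^bsub>U1\<^esub>"
      using complex_norm_square[of z] assms by (simp add: U1_def mult.commute)
  qed (use assms in \<open>simp_all add: U1_def\<close>)
qed

theorem proposition2p9:
  fixes \<psi> :: "'n::finite \<Rightarrow> complex ^ 2"
  assumes "\<And>i. norm (\<psi> i) = 1"
    and "\<And>i j. hinner (\<psi> i) (\<psi> j) \<noteq> 0"
  shows "(\<chi> i j. hinner (\<psi> i) (\<psi> j) / complex_of_real (cmod (hinner (\<psi> i) (\<psi> j))))
           \<in> (PC U1 :: (complex ^ 'n ^ 'n) set)"
proof -
  let ?u = "\<lambda>i j. hinner (\<psi> i) (\<psi> j) / complex_of_real (cmod (hinner (\<psi> i) (\<psi> j)))"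
  have unit: "cmod (?u i j) = 1" for i j
    \<comment> \<open>Nonvanishing matters: division by zero would yield 0, off the circle.\<close>
    using assms(2)[of i j] by (simp add: norm_divide)
  have diag: "?u i i = 1" for i
    using assms(1)[of i] by (simp add: hinner_self)
  have recip: "?u j i = inv\<^bsub>U1\<^esub> (?u i j)" for i j
    \<comment> \<open>The instance is fixed because the general symmetry law, used as a rewrite
      rule, would loop. What remains is that conjugation fixes the real denominator and preserves
      the modulus.\<close>
    unfolding inv_U1[OF unit] hinner_commute[of "\<psi> j" "\<psi> i"] by simp
  have "?u i j \<in> carrier U1" "?u i i = \<one>\<^bsub>U1\<^esub>" for i j
    using unit[of i j] diag[of i] by (simp_all add: U1_def)
  with recip show ?thesis
    unfolding PC_def mem_Collect_eq vec_lambda_beta by blast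
qed

end
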